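(* Let $K, L, N$ be positive integers with $L\le K$, let $0\le M\le N$, and let $R^*(M)$ denote the optimal rate-memory trade-off of the $(K,L,N)$ multi-access coded caching (MACC) scheme. Then $$R^*(M)\ \ge\ \max_{s\in\{1,2,\ldots,\min(K,N)\}}\left(s-\frac{\min(s+L-1,K)}{\lfloor N/s\rfloor}\,M\right).$$
   Context: Notation: for a positive integer $m$, $[m]=\{1,\ldots,m\}$. For integers $i$ and $K$, $\langle i\rangle_K$ denotes $i \bmod K$ if this is nonzero, and $K$ otherwise. The $(K,L,N)$ MACC network. A central server has a library of $N$ independent files $W_1,\ldots,W_N$, each of size 1 unit ($F$ bits; all sizes and entropies are measured in units of $F$ bits, so $H(W_n)=1$ for each $n$ and $H(W_1,\ldots,W_N)=N$). There are $K$ users $\mathcal{U}_1,\ldots,\mathcal{U}_K$, connected to the server by an error-free shared (broadcast) link, and $K$ caches $\mathcal{Z}_1,\ldots,\mathcal{Z}_K$, each of size $M$ units, $0\le M\le N$. User $\mathcal{U}_k$ has access to the $L$ cyclically consecutive caches with indices in $\mathcal{L}_k=\{k,\langle k+1\rangle_K,\ldots,\langle k+L-1\rangle_K\}$. Schemes. In the placement phase, without knowledge of the demands, the server stores in cache $\mathcal{Z}_k$ a content $Z_k$ which is an arbitrary function of the files $W_1,\ldots,W_N$ (coded placement is allowed) and has size at most $M$ units (so $H(Z_k)\le M$). In the delivery phase, user $\mathcal{U}_k$ demands a file $W_{d_k}$, where $d_k\in[N]$ is a realization of a random variable $D_k$; the variables $D_1,\ldots,D_K$ are independent and uniform on $[N]$.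 For each demand vector $\mathbf{d}=(d_1,\ldots,d_K)\in[N]^K$ the server broadcasts a transmission $X$, which is a function of the files (depending on $\mathbf{d}$), of size $R$ units (so $H(X)\le R$); $R\ge 0$ is called the rate. The decodability condition is that for every $k\in[K]$, $H(W_{d_k}\mid Z_{\mathcal{L}_k},D_k=d_k,X)=0$, where $Z_{\mathcal{L}_k}$ is the collection of contents $Z_j$, $j\in\mathcal{L}_k$. A memory-rate pair $(M,R)$ is achievable if there is a scheme with cache memory $M$ that satisfies the decodability condition with rate at most $R$ for every possible demand vector. The optimal rate-memory trade-off is $R^*(M)=\inf\{R:(M,R)\text{ is achievable}\}$. *)

theory Defs
  imports "HOL-Probability.Probability"
begin

text \<open>
  A realization of the library is a map \<open>w\<close> with \<open>w n\<close> the \<open>F\<close>-bit string stored in file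
  \<open>n \<in> {1..N}\<close>; a demand vector is a map \<open>d\<close> with \<open>d k \<in> {1..N}\<close> for \<open>k \<in> {1..K}\<close>.
\<close>

definition libraries :: "nat \<Rightarrow> nat \<Rightarrow> (nat \<Rightarrow> bool list) set" where
  "libraries N F = {1..N} \<rightarrow>\<^sub>E {bs. length bs = F}"

definition demands :: "nat \<Rightarrow> nat \<Rightarrow> (nat \<Rightarrow> nat) set" where
  "demands K N = {1..K} \<rightarrow>\<^sub>E {1..N}"

text \<open>
  Since the sample space is a full product with the uniform distribution, the files and the
  demands are all mutually independent, each file is uniform on the \<open>F\<close>-bit strings and each
  demand is uniform on \<open>{1..N}\<close>.
\<close>

definition macc_space :: "nat \<Rightarrow> nat \<Rightarrow> nat \<Rightarrow> ((nat \<Rightarrow> bool list) \<times> (nat \<Rightarrow> nat)) measure" where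
  "macc_space K N F = uniform_count_measure (libraries N F \<times> demands K N)"

definition file_of :: "nat \<Rightarrow> (nat \<Rightarrow> bool list) \<times> (nat \<Rightarrow> nat) \<Rightarrow> bool list" where
  "file_of n \<omega> = fst \<omega> n"

definition demand_of :: "nat \<Rightarrow> (nat \<Rightarrow> bool list) \<times> (nat \<Rightarrow> nat) \<Rightarrow> nat" where
  "demand_of k \<omega> = snd \<omega> k"

definition cyc :: "nat \<Rightarrow> nat \<Rightarrow> nat" where
  "cyc K i = (if i mod K = 0 then K else i mod K)"

definition accessible :: "nat \<Rightarrow> nat \<Rightarrow> nat \<Rightarrow> nat set" where
  "accessible K L k = (\<lambda>i. cyc K (k + i)) ` {..<L}"

text \<open>
  Sizes and entropies are in units of \<open>F\<close> bits, i.e. logarithms are taken to the base \<open>2 ^ F\<close>.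
  The size of a content (a function of the files) counts the bits needed to store any of its
  possible values. It bounds the entropy of the content (see \<open>entropy_le_size_units\<close> below), and
  for a file both are 1.
\<close>

definition size_units :: "nat \<Rightarrow> nat \<Rightarrow> ((nat \<Rightarrow> bool list) \<Rightarrow> 'c) \<Rightarrow> real" where
  "size_units N F f = log (2 ^ F) (real (card (f ` libraries N F)))"

text \<open>
  For random variables with finitely many values, the library's entropies are taken with respect
  to the counting measure on the set of values.
\<close>

definition H :: "nat \<Rightarrow> 'w measure \<Rightarrow> ('w \<Rightarrow> 'a) \<Rightarrow> real" where
  "H F P U = prob_space.entropy P (2 ^ F) (count_space (U ` space P)) U"

definition H_cond :: "nat \<Rightarrow> 'w measure \<Rightarrow> ('w \<Rightarrow> 'a) \<Rightarrow> ('w \<Rightarrow> 'b) \<Rightarrow> real" where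
  "H_cond F P U V =
     prob_space.conditional_entropy P (2 ^ F)
       (count_space (U ` space P)) (count_space (V ` space P)) U V"

text \<open>
  \<open>Z k\<close> is the content of cache \<open>k\<close> and \<open>X d\<close> the transmission for the demand vector \<open>d\<close>, both as
  functions of the files. Decodability is \<open>H(W\<^sub>d\<^sub>k | Z\<^sub>L\<^sub>k, D\<^sub>k = d\<^sub>k, X) = 0\<close>; the event
  \<open>D\<^sub>k = d\<^sub>k\<close> enters by conditioning the probability measure on it.
\<close>

definition decodable ::
  "nat \<Rightarrow> nat \<Rightarrow> nat \<Rightarrow> nat \<Rightarrow> (nat \<Rightarrow> (nat \<Rightarrow> bool list) \<Rightarrow> bool list) \<Rightarrow>
   ((nat \<Rightarrow> nat) \<Rightarrow> (nat \<Rightarrow> bool list) \<Rightarrow> bool list) \<Rightarrow> (nat \<Rightarrow> nat) \<Rightarrow> nat \<Rightarrow> bool" where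
  "decodable K L N F Z X d k \<longleftrightarrow>
     H_cond F
       (uniform_measure (macc_space K N F) {\<omega> \<in> space (macc_space K N F). demand_of k \<omega> = d k})
       (file_of (d k))
       (\<lambda>\<omega>. (restrict (\<lambda>j. Z j (fst \<omega>)) (accessible K L k), X d (fst \<omega>))) = 0"

text \<open>
  The choice of \<open>bool list\<close> for the values of \<open>Z k\<close> and \<open>X d\<close> is no restriction, as any finite
  alphabet embeds into it; the sizes are governed by \<open>size_units\<close>, not by list length.
\<close>

definition achievable :: "nat \<Rightarrow> nat \<Rightarrow> nat \<Rightarrow> real \<Rightarrow> real \<Rightarrow> bool" where
  "achievable K L N M R \<longleftrightarrow> 0 \<le> R \<and>
     (\<exists>F \<ge> 1. \<exists>Z X.
        (\<forall>k \<in> {1..K}. size_units N F (Z k) \<le> M) \<and>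
        (\<forall>d \<in> demands K N. size_units N F (X d) \<le> R \<and>
           (\<forall>k \<in> {1..K}. decodable K L N F Z X d k)))"

definition R_star :: "nat \<Rightarrow> nat \<Rightarrow> nat \<Rightarrow> real \<Rightarrow> real" where
  "R_star K L N M = Inf {R. achievable K L N M R}"

lemma finite_libraries: "finite (libraries N F)"
  unfolding libraries_def
  using finite_lists_length_eq[of "UNIV :: bool set" F] by (simp add: finite_PiE)

lemma libraries_nonempty: "libraries N F \<noteq> {}"
proof -
  have "replicate F True \<in> {bs. length bs = F}"
    by simp
  then show ?thesis
    unfolding libraries_def by (metis PiE_eq_empty_iff empty_iff)
qed

lemma finite_demands: "finite (demands K N)"
  unfolding demands_def by (simp add: finite_PiE)

lemma demands_nonempty: "1 \<le> N \<Longrightarrow> demands K N \<noteq> {}"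
  by (simp add: demands_def PiE_eq_empty_iff)

lemma space_macc_space: "space (macc_space K N F) = libraries N F \<times> demands K N"
  unfolding macc_space_def by (rule space_uniform_count_measure)

lemma prob_space_macc_space: "1 \<le> N \<Longrightarrow> prob_space (macc_space K N F)"
  unfolding macc_space_def
  by (rule prob_space_uniform_count_measure)
     (simp_all add: finite_libraries finite_demands libraries_nonempty demands_nonempty)

lemma simple_function_macc_space: "simple_function (macc_space K N F) U"
proof -
  have "finite (space (macc_space K N F))"
    by (simp add: space_macc_space finite_libraries finite_demands)
  moreover have "sets (macc_space K N F) = Pow (space (macc_space K N F))"
    by (simp add: macc_space_def sets_uniform_count_measure space_uniform_count_measure)
  ultimately show ?thesis
    unfolding simple_function_def by blast
qed

lemma entropy_le_size_units:
  assumes "1 \<le> N" "1 \<le> F"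
  shows "H F (macc_space K N F) (\<lambda>\<omega>. f (fst \<omega>)) \<le> size_units N F f"
proof -
  let ?P = "macc_space K N F" and ?U = "\<lambda>\<omega>. f (fst \<omega>)"
  interpret prob_space ?P
    by (rule prob_space_macc_space[OF assms(1)])
  have "(1::real) < 2 ^ F"
    using assms(2) by (intro one_less_power) auto
  then interpret information_space ?P "2 ^ F"
    by unfold_locales
  have "fst ` (libraries N F \<times> demands K N) = libraries N F"
    using demands_nonempty[OF assms(1)] by (simp add: fst_image_times)
  moreover have "?U ` space ?P = f ` fst ` (libraries N F \<times> demands K N)"
    by (simp only: image_image space_macc_space)
  ultimately have im: "?U ` space ?P = f ` libraries N F"
    by simp
  have "simple_distributed ?P ?U (\<lambda>x. prob (?U -` {x} \<inter> space ?P))"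
    by (rule simple_distributedI[OF simple_function_macc_space measure_nonneg refl])
  from entropy_le_card[OF this] show ?thesis
    unfolding H_def size_units_def im .
qed

end

theory Submission
  imports Defs
begin

text \<open>
  Fix \<open>s\<close> and put \<open>q = \<lfloor>N / s\<rfloor>\<close>. In \<open>q\<close> rounds of demands the users \<open>1..s\<close> ask for the \<open>s * q\<close>
  distinct files \<open>1..s * q\<close>. They see only the caches \<open>1..min (s + L - 1) K\<close>, so these caches and
  the \<open>q\<close> transmissions together determine the \<open>s * q\<close> files. Counting values gives
  \<open>s * q \<le> min (s + L - 1) K * M + q * R\<close>. Vanishing conditional entropy is used only in the form
  of functional dependence.
\<close>

section \<open>Vanishing conditional entropy\<close>

text \<open>The conditional entropy is a sum of nonnegative terms, so it vanishes only termwise;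
  this forces each joint probability to be 0 or equal to the marginal of \<open>V\<close>. Outcomes
  of mass zero are exempt because the lemma is applied to a conditioned measure, whose space still
  contains the outcomes outside the event.\<close>

lemma H_cond_eq_0_iff:
  assumes "prob_space P" and fin: "finite (space P)" and sets: "sets P = Pow (space P)"
    and F: "1 \<le> F"
  shows "H_cond F P U V = 0 \<longleftrightarrow>
    (\<forall>\<omega> \<in> space P. \<forall>\<omega>' \<in> space P. 0 < measure P {\<omega>} \<longrightarrow> 0 < measure P {\<omega>'} \<longrightarrow>
       V \<omega> = V \<omega>' \<longrightarrow> U \<omega> = U \<omega>')"
    (is "_ \<longleftrightarrow> ?det")
proof -
  interpret prob_space P by fact
  have b: "(1::real) < 2 ^ F"
    using F by (intro one_less_power) auto
  then interpret information_space P "2 ^ F"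
    by unfold_locales
  have simple: "simple_function P f" for f :: "'a \<Rightarrow> 'd"
    unfolding simple_function_def using fin sets by blast
  define UV where "UV = (\<lambda>\<omega>. (U \<omega>, V \<omega>))"
  define pV where "pV v = prob (V -` {v} \<inter> space P)" for v
  define pUV where "pUV z = prob (UV -` {z} \<inter> space P)" for z
  have dV: "simple_distributed P V pV"
    unfolding pV_def by (rule simple_distributedI[OF simple measure_nonneg refl])
  have dUV: "simple_distributed P (\<lambda>\<omega>. (U \<omega>, V \<omega>)) pUV"
    unfolding pUV_def UV_def[symmetric]
    by (rule simple_distributedI[OF simple measure_nonneg refl])
  \<comment> \<open>With the sign moved inside, each summand is nonnegative: the joint probability
    is at most the marginal, so the logarithm is at most 0.\<close>
  define tm where "tm z = - (pUV z * log (2 ^ F) (pUV z / pV (snd z)))" for z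
  have H: "H_cond F P U V = (\<Sum>z \<in> UV ` space P. tm z)"
    unfolding H_cond_def conditional_entropy_eq[OF dV dUV] tm_def UV_def
    by (simp add: case_prod_unfold sum_negf)
  have pos: "0 \<le> pUV z" for z
    by (simp add: pUV_def)
  have le: "pUV z \<le> pV (snd z)" for z
    unfolding pUV_def pV_def by (rule finite_measure_mono) (auto simp: UV_def sets)
  have tm_nonneg: "0 \<le> tm z" for z
  proof (cases "pUV z = 0")
    case False
    with pos[of z] le[of z] have "log (2 ^ F) (pUV z / pV (snd z)) \<le> 0"
      using b by (subst log_le_zero_cancel_iff) (auto simp: divide_simps)
    then show ?thesis
      using pos[of z] by (simp add: tm_def mult_nonneg_nonpos)
  qed (simp add: tm_def)
  have tm_0_iff: "tm z = 0 \<longleftrightarrow> pUV z = 0 \<or> pUV z = pV (snd z)" for z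
  proof (cases "pUV z = 0")
    case False
    with pos[of z] le[of z] have "0 < pUV z" "0 < pV (snd z)" by auto
    then show ?thesis
      using b by (auto simp: tm_def log_eq_one log_def)
  qed (simp add: tm_def)
  have "H_cond F P U V = 0 \<longleftrightarrow> (\<forall>z \<in> UV ` space P. tm z = 0)"
    unfolding H by (rule sum_nonneg_eq_0_iff) (use fin tm_nonneg in auto)
  also have "\<dots> \<longleftrightarrow> ?det"
  proof
    assume all: "\<forall>z \<in> UV ` space P. tm z = 0"
    show ?det
    proof (intro ballI impI, rule ccontr)
      fix \<omega> \<omega>'
      assume \<omega>: "\<omega> \<in> space P" "\<omega>' \<in> space P" "0 < prob {\<omega>}" "0 < prob {\<omega>'}"
        "V \<omega> = V \<omega>'" "U \<omega> \<noteq> U \<omega>'"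
      \<comment> \<open>The joint fibre of \<open>\<omega>\<close> has positive mass, so its
        probability equals that of the whole \<open>V\<close>-fibre. But \<open>\<omega>'\<close>
        lies in the \<open>V\<close>-fibre, outside the joint one, and adds positive mass.\<close>
      have "prob {\<omega>} \<le> pUV (UV \<omega>)"
        unfolding pUV_def using \<omega> by (intro finite_measure_mono) (auto simp: sets)
      then have eq: "pUV (UV \<omega>) = pV (V \<omega>)"
        using all \<omega> tm_0_iff[of "UV \<omega>"] by (auto simp: UV_def)
      have "pUV (UV \<omega>) + prob {\<omega>'} = prob ((UV -` {UV \<omega>} \<inter> space P) \<union> {\<omega>'})"
        unfolding pUV_def using \<omega>
        by (intro finite_measure_Union[symmetric]) (auto simp: sets UV_def)
      also have "\<dots> \<le> pV (V \<omega>)"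
        unfolding pV_def using \<omega> by (intro finite_measure_mono) (auto simp: sets UV_def)
      finally show False
        using eq \<omega> by simp
    qed
  next
    assume det: ?det
    have meas: "prob B = (\<Sum>\<omega> \<in> B. prob {\<omega>})" if "B \<subseteq> space P" for B
      using that fin sets by (intro finite_measure_eq_sum_singleton) (auto intro: finite_subset)
    show "\<forall>z \<in> UV ` space P. tm z = 0"
    proof
      fix z
      show "tm z = 0"
      proof (cases "pUV z = 0")
        case False
        \<comment> \<open>Compared with an outcome of positive mass in the joint fibre, all points
          of the \<open>V\<close>-fibre with another value of \<open>U\<close> must be null. Hence
          both fibres have the same mass.\<close>
        then obtain \<omega> where \<omega>: "\<omega> \<in> space P" "UV \<omega> = z" "prob {\<omega>} \<noteq> 0"
          unfolding pUV_def by (subst (asm) meas) (auto elim!: sum.not_neutral_contains_not_neutral)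
        have null: "prob {\<omega>'} = 0"
          if "\<omega>' \<in> V -` {snd z} \<inter> space P - UV -` {z} \<inter> space P" for \<omega>'
        proof (rule ccontr)
          assume "prob {\<omega>'} \<noteq> 0"
          moreover have "\<omega>' \<in> space P" "V \<omega> = V \<omega>'" "U \<omega> \<noteq> U \<omega>'"
            using that \<omega> by (auto simp: UV_def)
          ultimately show False
            using det \<omega> by (metis zero_less_measure_iff)
        qed
        have "(\<Sum>\<omega> \<in> UV -` {z} \<inter> space P. prob {\<omega>})
            = (\<Sum>\<omega> \<in> V -` {snd z} \<inter> space P. prob {\<omega>})"
          by (rule sum.mono_neutral_left) (use fin null in \<open>auto simp: UV_def\<close>)
        then have "pUV z = pV (snd z)"
          unfolding pUV_def pV_def by (simp only: meas[OF Int_lower2])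
        then show ?thesis
          by (simp add: tm_0_iff)
      qed (simp add: tm_0_iff)
    qed
  qed
  finally show ?thesis .
qed

text \<open>Under the uniform measure every outcome has positive mass, so conditioning on the demand
  of user \<open>k\<close> leaves positive mass exactly on the event. The file, the caches and
  \<open>X d\<close> depend only on the library, and each library \<open>w\<close> occurs in the
  event as \<open>(w, d)\<close>; hence the demand component drops out.\<close>

lemma decodable_iff:
  assumes N: "1 \<le> N" and F: "1 \<le> F" and d: "d \<in> demands K N" and k: "k \<in> {1..K}"
  shows "decodable K L N F Z X d k \<longleftrightarrow>
    (\<forall>w \<in> libraries N F. \<forall>w' \<in> libraries N F.
       (\<forall>j \<in> accessible K L k. Z j w = Z j w') \<longrightarrow> X d w = X d w' \<longrightarrow> w (d k) = w' (d k))"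
proof -
  let ?P = "macc_space K N F"
  let ?A = "{\<omega> \<in> space ?P. demand_of k \<omega> = d k}"
  let ?Q = "uniform_measure ?P ?A"
  let ?V = "\<lambda>\<omega>. (restrict (\<lambda>j. Z j (fst \<omega>)) (accessible K L k), X d (fst \<omega>))"
  interpret P: prob_space ?P
    by (rule prob_space_macc_space[OF N])
  have fin: "finite (space ?P)"
    by (simp add: space_macc_space finite_libraries finite_demands)
  have sets: "sets ?P = Pow (space ?P)"
    by (simp add: macc_space_def sets_uniform_count_measure space_uniform_count_measure)
  have single: "0 < measure ?P {\<omega>}" if "\<omega> \<in> space ?P" for \<omega>
    using that fin unfolding macc_space_def
    by (subst measure_uniform_count_measure)
       (auto simp: space_uniform_count_measure card_gt_0_iff simp del: finite_SigmaI)
  obtain w0 where "w0 \<in> libraries N F"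
    using libraries_nonempty by blast
  then have A0: "(w0, d) \<in> ?A"
    using d by (simp add: space_macc_space demand_of_def)
  then have "measure ?P {(w0, d)} \<le> measure ?P ?A"
    by (intro P.finite_measure_mono) (auto simp: sets)
  with single[of "(w0, d)"] A0 have A: "0 < measure ?P ?A"
    by auto
  have eA: "emeasure ?P ?A \<noteq> 0" "emeasure ?P ?A \<noteq> \<infinity>"
    using A by (auto simp: P.emeasure_eq_measure)
  have Q: "0 < measure ?Q {\<omega>} \<longleftrightarrow> \<omega> \<in> ?A" if "\<omega> \<in> space ?P" for \<omega>
  proof -
    have "measure ?Q {\<omega>} = measure ?P (?A \<inter> {\<omega>}) / measure ?P ?A"
      using eA that by (intro measure_uniform_measure) (auto simp: sets)
    moreover have "?A \<inter> {\<omega>} = (if \<omega> \<in> ?A then {\<omega>} else {})"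
      by auto
    ultimately show ?thesis
      using A single[OF that] by (simp add: zero_less_divide_iff)
  qed
  have "decodable K L N F Z X d k \<longleftrightarrow>
      (\<forall>\<omega> \<in> ?A. \<forall>\<omega>' \<in> ?A. ?V \<omega> = ?V \<omega>' \<longrightarrow> file_of (d k) \<omega> = file_of (d k) \<omega>')"
  proof -
    define A where "A = ?A"
    define pos where "pos \<omega> \<longleftrightarrow> 0 < measure ?Q {\<omega>}" for \<omega>
    \<comment> \<open>This turns the mass conditions of \<open>H_cond_eq_0_iff\<close> into
      membership in the event.\<close>
    have A: "\<omega> \<in> A \<longleftrightarrow> \<omega> \<in> space ?P \<and> pos \<omega>" for \<omega>
      using Q[of \<omega>] unfolding A_def pos_def by blast
    have "decodable K L N F Z X d k \<longleftrightarrow>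
      (\<forall>\<omega> \<in> space ?Q. \<forall>\<omega>' \<in> space ?Q. pos \<omega> \<longrightarrow> pos \<omega>' \<longrightarrow>
         ?V \<omega> = ?V \<omega>' \<longrightarrow> file_of (d k) \<omega> = file_of (d k) \<omega>')"
      unfolding decodable_def pos_def
    proof (rule H_cond_eq_0_iff[OF prob_space_uniform_measure[OF eA] _ _ F])
      show "finite (space ?Q)"
        using fin by (simp only: space_uniform_measure)
      show "sets ?Q = Pow (space ?Q)"
        using sets by (simp only: space_uniform_measure sets_uniform_measure)
    qed
    then show ?thesis
      unfolding A_def[symmetric] Ball_def A space_uniform_measure by metis
  qed
  also have "\<dots> \<longleftrightarrow>
    (\<forall>w \<in> libraries N F. \<forall>w' \<in> libraries N F.
       (\<forall>j \<in> accessible K L k. Z j w = Z j w') \<longrightarrow> X d w = X d w' \<longrightarrow> w (d k) = w' (d k))"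
    (is "?l \<longleftrightarrow> ?r")
  proof
    assume l: ?l
    show ?r
    proof (intro ballI impI)
      fix w w'
      assume w: "w \<in> libraries N F" "w' \<in> libraries N F"
        "\<forall>j \<in> accessible K L k. Z j w = Z j w'" "X d w = X d w'"
      then have "(w, d) \<in> ?A" "(w', d) \<in> ?A"
        using d by (auto simp: space_macc_space demand_of_def)
      moreover have "?V (w, d) = ?V (w', d)"
        using w by (auto simp: restrict_def fun_eq_iff)
      ultimately have "file_of (d k) (w, d) = file_of (d k) (w', d)"
        using l by blast
      then show "w (d k) = w' (d k)"
        by (simp add: file_of_def)
    qed
  next
    assume r: ?r
    show ?l
    proof (intro ballI impI)
      fix \<omega> \<omega>'
      assume \<omega>: "\<omega> \<in> ?A" "\<omega>' \<in> ?A" "?V \<omega> = ?V \<omega>'"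
      have V: "fst (?V \<omega>) = fst (?V \<omega>')" "snd (?V \<omega>) = snd (?V \<omega>')"
        by (simp_all only: \<omega>(3))
      have "Z j (fst \<omega>) = Z j (fst \<omega>')" if "j \<in> accessible K L k" for j
        using fun_cong[OF V(1), of j] by (simp add: that)
      moreover have "X d (fst \<omega>) = X d (fst \<omega>')"
        using V(2) by simp
      moreover have "fst \<omega> \<in> libraries N F" "fst \<omega>' \<in> libraries N F"
        using \<omega>(1,2) by (auto simp: space_macc_space)
      ultimately show "file_of (d k) \<omega> = file_of (d k) \<omega>'"
        using r unfolding file_of_def by blast
    qed
  qed
  finally show ?thesis .
qed

section \<open>Counting\<close>

text \<open>On \<open>A\<close>, \<open>f\<close> factors through \<open>g\<close>: evaluating
  \<open>f\<close> at a chosen representative of each fibre of \<open>g\<close> maps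
  \<open>g\<close> A\<open>onto\<close>f \<open>A\<close>.\<close>

lemma card_image_le_if_determined:
  assumes "finite A" and "\<And>x y. x \<in> A \<Longrightarrow> y \<in> A \<Longrightarrow> g x = g y \<Longrightarrow> f x = f y"
  shows "card (f ` A) \<le> card (g ` A)"
proof -
  have "f x = f (inv_into A g (g x))" if "x \<in> A" for x
    using that by (intro assms(2)) (auto simp: inv_into_into f_inv_into_f)
  then have "f ` A \<subseteq> (\<lambda>y. f (inv_into A g y)) ` g ` A"
    by (auto simp: image_iff)
  then show ?thesis
    using assms(1) by (intro surj_card_le) auto
qed

lemma card_image_restrict_libraries:
  assumes "n \<le> N"
  shows "card ((\<lambda>w. restrict w {1..n}) ` libraries N F) = (2 ^ F) ^ n"
proof -
  let ?B = "{bs :: bool list. length bs = F}"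
  have "(\<lambda>w. restrict w {1..n}) ` libraries N F = {1..n} \<rightarrow>\<^sub>E ?B"
  proof (intro equalityI subsetI)
    fix v assume v: "v \<in> {1..n} \<rightarrow>\<^sub>E ?B"
    \<comment> \<open>Any choice of the first \<open>n\<close> files extends to a library: the
      remaining files get an arbitrary string of length \<open>F\<close>, and indices beyond
      \<open>N\<close> the value required by extensionality.\<close>
    let ?w = "\<lambda>i. if i \<in> {1..n} then v i
      else if i \<in> {1..N} then replicate F True else undefined"
    have "?w \<in> libraries N F"
      unfolding libraries_def using v assms by (auto simp: PiE_iff extensional_def)
    moreover have "restrict ?w {1..n} = v"
      using v by (auto simp: fun_eq_iff restrict_def PiE_iff extensional_def)
    ultimately show "v \<in> (\<lambda>w. restrict w {1..n}) ` libraries N F"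
      by (rule image_eqI[where f = "\<lambda>w. restrict w {1..n}", OF sym, rotated])
  qed (use assms in \<open>auto simp: libraries_def PiE_iff\<close>)
  moreover have "card ?B = 2 ^ F"
    using card_lists_length_eq[of "UNIV :: bool set" F] by simp
  ultimately show ?thesis
    by (simp add: card_PiE)
qed

text \<open>The logarithmic bound can be exponentiated because the set of libraries is nonempty,
  which makes the number of values positive.\<close>

lemma card_image_le_powr_size_units:
  assumes "1 \<le> F" and "size_units N F f \<le> M"
  shows "real (card (f ` libraries N F)) \<le> (2 ^ F) powr M"
proof -
  have "(1::real) < 2 ^ F"
    using assms(1) by (intro one_less_power) auto
  moreover have "0 < real (card (f ` libraries N F))"
    by (simp add: card_gt_0_iff finite_libraries libraries_nonempty)
  ultimately show ?thesis
    using assms(2) by (simp add: size_units_def log_le_iff)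
qed

text \<open>This is the counting counterpart of subadditivity of entropy: a tuple takes at most as
  many values as the product of its components' alphabets. It serves for the caches as well as for
  the transmissions.\<close>

lemma card_image_restrict_le_powr:
  assumes "finite I" and "1 \<le> F" and "\<And>i. i \<in> I \<Longrightarrow> size_units N F (f i) \<le> M"
  shows "real (card ((\<lambda>w. restrict (\<lambda>i. f i w) I) ` libraries N F))
    \<le> (2 ^ F) powr (real (card I) * M)"
proof -
  have "card ((\<lambda>w. restrict (\<lambda>i. f i w) I) ` libraries N F)
      \<le> card (\<Pi>\<^sub>E i \<in> I. f i ` libraries N F)"
    using assms(1) by (intro card_mono finite_PiE) (auto simp: finite_libraries)
  also have "\<dots> = (\<Prod>i \<in> I. card (f i ` libraries N F))"
    using assms(1) by (rule card_PiE)
  finally have "real (card ((\<lambda>w. restrict (\<lambda>i. f i w) I) ` libraries N F))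
      \<le> (\<Prod>i \<in> I. real (card (f i ` libraries N F)))"
    by (simp only: of_nat_le_iff[symmetric, where 'a = real] of_nat_prod)
  also have "\<dots> \<le> (\<Prod>i \<in> I. (2 ^ F) powr M)"
    using assms by (intro prod_mono) (auto intro: card_image_le_powr_size_units)
  also have "\<dots> = (2 ^ F) powr (real (card I) * M)"
    by (simp add: powr_power mult.commute)
  finally show ?thesis .
qed

section \<open>The cut-set bound\<close>

text \<open>Wrapping around never increases a positive index, so user \<open>k\<close> reaches no
  cache beyond \<open>k + L - 1\<close>, and none beyond \<open>K\<close>.\<close>

lemma accessible_subset:
  assumes "k \<in> {1..s}" and "1 \<le> K"
  shows "accessible K L k \<subseteq> {1..min (s + L - 1) K}"
proof
  fix j assume "j \<in> accessible K L k"
  then obtain i where i: "i < L" "j = cyc K (k + i)"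
    by (auto simp: accessible_def)
  have "cyc K (k + i) \<le> k + i"
    using assms by (auto simp: cyc_def intro: dvd_imp_le)
  moreover have "1 \<le> cyc K (k + i)" "cyc K (k + i) \<le> K"
    using assms by (auto simp: cyc_def intro: less_imp_le)
  ultimately show "j \<in> {1..min (s + L - 1) K}"
    using i assms by auto
qed

lemma achievable_cut_set:
  assumes "achievable K L N M R" and K: "1 \<le> K" and N: "1 \<le> N" and s: "s \<in> {1..min K N}"
  shows "real s * real (N div s) \<le> real (min (s + L - 1) K) * M + real (N div s) * R"
proof -
  let ?q = "N div s" and ?m = "min (s + L - 1) K"
  from assms(1) obtain F Z X where F: "1 \<le> F"
    and ZM: "\<And>k. k \<in> {1..K} \<Longrightarrow> size_units N F (Z k) \<le> M"
    and XR: "\<And>d. d \<in> demands K N \<Longrightarrow> size_units N F (X d) \<le> R"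
    and dec: "\<And>d k. d \<in> demands K N \<Longrightarrow> k \<in> {1..K} \<Longrightarrow> decodable K L N F Z X d k"
    unfolding achievable_def by blast
  have b: "(1::real) < 2 ^ F"
    using F by (intro one_less_power) auto
  have sq: "s * ?q \<le> N"
    by simp
  \<comment> \<open>Rounds count from 0 and users from 1, so round \<open>t\<close> requests the
    block \<open>t * s + 1, ..., t * s + s\<close>. The users beyond \<open>s\<close> receive file 1
    as an arbitrary legal demand.\<close>
  define D where "D t = restrict (\<lambda>k. if k \<le> s then t * s + k else 1) {1..K}" for t
  have D: "D t \<in> demands K N" if "t < ?q" for t
  proof -
    have "t * s + k \<le> N" if "k \<le> s" for k
    proof -
      have "t * s + k \<le> Suc t * s" using that by simp
      also have "\<dots> \<le> ?q * s" using \<open>t < ?q\<close> by (intro mult_right_mono) auto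
      also have "\<dots> \<le> N" by simp
      finally show ?thesis .
    qed
    then show ?thesis
      using N by (auto simp: D_def demands_def)
  qed
  let ?gZ = "\<lambda>w. restrict (\<lambda>j. Z j w) {1..?m}"
  let ?gX = "\<lambda>w. restrict (\<lambda>t. X (D t) w) {..<?q}"
  let ?A = "libraries N F"
  have "card ((\<lambda>w. restrict w {1..s * ?q}) ` ?A) \<le> card ((\<lambda>w. (?gZ w, ?gX w)) ` ?A)"
  proof (rule card_image_le_if_determined[OF finite_libraries])
    fix w w' assume w: "w \<in> ?A" "w' \<in> ?A" and eq: "(?gZ w, ?gX w) = (?gZ w', ?gX w')"
    have "?gZ w = ?gZ w'" "?gX w = ?gX w'"
      by (rule Pair_inject[OF eq], assumption)+
    note eq' = fun_cong[OF this(1)] fun_cong[OF this(2)]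
    have Z: "Z j w = Z j w'" if "j \<in> {1..?m}" for j
      using eq'(1)[of j] by (simp only: restrict_apply'[OF that])
    have X: "X (D t) w = X (D t) w'" if "t < ?q" for t
      using eq'(2)[of t] that by (simp only: restrict_apply' lessThan_iff)
    have "w n = w' n" if n: "n \<in> {1..s * ?q}" for n
    proof -
      \<comment> \<open>Files are numbered from 1, so \<open>n - 1\<close> is divided by
        \<open>s\<close>: the quotient is the round and the remainder plus 1 the user requesting
        file \<open>n\<close>.\<close>
      define t where "t = (n - 1) div s"
      define k where "k = (n - 1) mod s + 1"
      have t: "t < ?q"
        using n s unfolding t_def by (auto simp: less_mult_imp_div_less mult.commute)
      have k: "k \<in> {1..s}"
        using s by (auto simp: k_def Suc_le_eq)
      have nk: "n = t * s + k"
        using n by (simp add: t_def k_def)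
      have kK: "k \<in> {1..K}"
        using k s by auto
      \<comment> \<open>All caches that user \<open>k\<close> reads lie among the first
        \<open>?m\<close>, where the two libraries agree; decodability in round \<open>t\<close>
        then gives agreement on the requested file.\<close>
      have "w (D t k) = w' (D t k)"
        using dec[OF D[OF t] kK] w X[OF t] Z accessible_subset[OF k K, of L]
        unfolding decodable_iff[OF N F D[OF t] kK] by (meson subsetD)
      then show ?thesis
        using kK k by (simp add: D_def nk)
    qed
    then show "restrict w {1..s * ?q} = restrict w' {1..s * ?q}"
      by (auto simp: restrict_def)
  qed
  \<comment> \<open>Caches and transmissions are now counted separately; comparing exponents to the
    base \<open>2 ^ F\<close> gives the bound.\<close>
  also have "\<dots> \<le> card (?gZ ` ?A \<times> ?gX ` ?A)"
    by (intro card_mono) (auto simp: finite_libraries)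
  finally have "(2 ^ F) ^ (s * ?q) \<le> card (?gZ ` ?A) * card (?gX ` ?A)"
    by (simp only: card_image_restrict_libraries[OF sq] card_cartesian_product)
  then have "(2 ^ F :: real) ^ (s * ?q) \<le> real (card (?gZ ` ?A)) * real (card (?gX ` ?A))"
    by (simp only: of_nat_le_iff[symmetric, where 'a = real] of_nat_mult
        of_nat_power of_nat_numeral)
  also have "\<dots> \<le> (2 ^ F) powr (real ?m * M) * (2 ^ F) powr (real ?q * R)"
  proof (rule mult_mono)
    show "real (card (?gZ ` ?A)) \<le> (2 ^ F) powr (real ?m * M)"
      using card_image_restrict_le_powr[of "{1..?m}" F N Z M] F ZM by simp
    show "real (card (?gX ` ?A)) \<le> (2 ^ F) powr (real ?q * R)"
      using card_image_restrict_le_powr[of "{..<?q}" F N "\<lambda>t. X (D t)" R] F XR D by simp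
  qed auto
  finally have "(2 ^ F :: real) powr real (s * ?q) \<le> (2 ^ F) powr (real ?m * M + real ?q * R)"
    by (simp add: powr_add powr_realpow del: of_nat_mult)
  then show ?thesis
    using b by (subst (asm) powr_le_cancel_iff) simp_all
qed

text \<open>The infimum in \<open>R_star\<close> is controlled by lower bounds only if some rate is
  achievable. The witness has one-bit files and constant caches, and broadcasts the whole library
  whatever the demands.\<close>

lemma achievable_everything:
  assumes "1 \<le> N" and "0 \<le> M"
  shows "achievable K L N M (real N)"
proof -
  define X where "X = (\<lambda>(d :: nat \<Rightarrow> nat) w. map (\<lambda>n. hd (w n)) [1..<Suc N] :: bool list)"
  have inj: "w n = w' n"
    if w: "w \<in> libraries N 1" "w' \<in> libraries N 1" and eq: "X d w = X d w'" and n: "n \<in> {1..N}"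
    for w w' d n
  proof -
    have "length (w n) = 1" "length (w' n) = 1"
      using w n by (auto simp: libraries_def)
    moreover have "hd (w n) = hd (w' n)"
      using eq n by (simp add: X_def del: upt_Suc)
    ultimately show ?thesis
      by (simp add: list_eq_iff_nth_eq hd_conv_nth flip: length_greater_0_conv)
  qed
  have "card (X d ` libraries N 1) \<le> 2 ^ N" for d
  proof -
    have "card (X d ` libraries N 1) \<le> card {bs. set bs \<subseteq> (UNIV :: bool set) \<and> length bs = N}"
      by (intro card_mono finite_lists_length_eq) (auto simp: X_def)
    then show ?thesis
      using card_lists_length_eq[of "UNIV :: bool set" N] by simp
  qed
  then have "real (card (X d ` libraries N 1)) \<le> 2 ^ N" for d
    by (simp only: of_nat_le_iff[symmetric, where 'a = real] of_nat_power of_nat_numeral)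
  moreover have "0 < real (card (X d ` libraries N 1))" for d
    by (simp add: card_gt_0_iff finite_libraries libraries_nonempty)
  ultimately have "size_units N 1 (X d) \<le> real N" for d
    by (simp add: size_units_def log_le_iff powr_realpow)
  \<comment> \<open>A constant content has a single value, hence size \<open>log 1 = 0\<close>,
    which fits every \<open>M\<close> allowed.\<close>
  moreover have "size_units N 1 (\<lambda>_. []) \<le> M"
    using assms(2) by (simp add: size_units_def libraries_nonempty image_constant_conv)
  moreover have "decodable K L N 1 (\<lambda>_ _. []) X d k" if "d \<in> demands K N" "k \<in> {1..K}" for d k
  proof -
    have "d k \<in> {1..N}"
      using that by (auto simp: demands_def)
    then show ?thesis
      using inj by (subst decodable_iff) (use that assms(1) in auto)
  qed
  ultimately show ?thesis
    unfolding achievable_def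
    by (intro conjI exI[of _ "1 :: nat"] exI[of _ "\<lambda>_ :: nat. \<lambda>_. []"] exI[of _ X] ballI) simp_all
qed

theorem theorem1:
  fixes K L N :: nat and M :: real
  assumes "1 \<le> K" and "1 \<le> L" and "1 \<le> N" and "L \<le> K"
    and "0 \<le> M" and "M \<le> real N"
  shows "R_star K L N M \<ge>
    (MAX s \<in> {1..min K N}.
       real s - real (min (s + L - 1) K) / of_int \<lfloor>real N / real s\<rfloor> * M)"
proof -
  have "real s - real (min (s + L - 1) K) / of_int \<lfloor>real N / real s\<rfloor> * M \<le> R_star K L N M"
    if s: "s \<in> {1..min K N}" for s
    unfolding R_star_def
  proof (rule cInf_greatest)
    show "{R. achievable K L N M R} \<noteq> {}"
      using achievable_everything[OF assms(3,5)] by blast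
  next
    fix R assume "R \<in> {R. achievable K L N M R}"
    then have "real s * real (N div s) \<le> real (min (s + L - 1) K) * M + real (N div s) * R"
      using achievable_cut_set[OF _ assms(1,3) s] by blast
    \<comment> \<open>Since \<open>s\<close> is at most \<open>N\<close>, there is at least one
      round, and the cut-set inequality can be divided by the number of rounds.\<close>
    moreover have "0 < real (N div s)"
      using s by (simp add: div_greater_zero_iff)
    ultimately have "real s - real (min (s + L - 1) K) / real (N div s) * M \<le> R"
      by (simp add: field_simps)
    then show "real s - real (min (s + L - 1) K) / of_int \<lfloor>real N / real s\<rfloor> * M \<le> R"
      by (simp add: floor_divide_of_nat_eq)
  qed
  then show ?thesis
    using assms(1,3) by (subst Max_le_iff) auto
qed

end
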